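(* Let $m\ge3$, let $d_1,\dots,d_m\ge1$ be integers, let $\mathcal D^i$ be a dyadic cube grid in $\mathbb R^{d_i}$ for $1\le i\le m$, let $0<\eta<1$, and set $$\Phi(k_1,\dots,k_{m-1})=k_1+\cdots+k_{m-1},\qquad (k_1,\dots,k_{m-1})\in\mathbb Z^{m-1}.$$ There are finite incomparable $\eta$-sparse families $\mathcal G_N\subset\mathcal Z_\Phi$, $N\ge2$ (one for each integer $N\ge2$), with $|\mathrm{sh}(\mathcal G_N)|=1$, such that $$\lim_{N\to\infty}\int_{\mathrm{sh}(\mathcal G_N)}\left[\exp\left(c\,h_{\mathcal G_N}^{\beta}\right)-1\right]=\infty\qquad\text{for every } c>0,\ \ \beta>\frac1{m-1}.$$
   Context: A dyadic (cube) grid in $\mathbb R^n$ is a collection of half-open axis-parallel cubes with side lengths $2^k$, $k\in\mathbb Z$, such that for every $k\in\mathbb Z$ the cubes of side length $2^k$ in the collection partition $\mathbb R^n$, and any two intersecting cubes of the collection are nested. $\mathcal D=\mathcal D^1\times\cdots\times\mathcal D^m$ is the family of rectangles $I=I^1\times\cdots\times I^m\subset\mathbb R^{d_1}\times\cdots\times\mathbb R^{d_m}$ with $I^i\in\mathcal D^i$. $\mathcal Z_\Phi\subset\mathcal D$ is the family of rectangles in $\mathcal D$ with side-length tuple $(2^{k_1},\dots,2^{k_{m-1}},2^{\Phi(k_1,\dots,k_{m-1})})$ for some $(k_1,\dots,k_{m-1})\in\mathbb Z^{m-1}$. For $\mathcal G\subset\mathcal D$, $h_{\mathcal G}=\sum_{I\in\mathcal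 G}\mathbf 1_I$ and $\mathrm{sh}(\mathcal G)=\bigcup_{I\in\mathcal G}I$. $\mathcal G$ is incomparable if no two distinct members contain one another, and $\eta$-sparse if there are pairwise disjoint measurable sets $E_I\subset I$, $I\in\mathcal G$, with $|E_I|\ge\eta|I|$. $|\cdot|$ is Lebesgue measure. *)

theory Defs
  imports "HOL-Analysis.Analysis" "HOL-Library.Disjoint_Sets"
begin

text \<open>A point of \<open>\<real>\<^sup>n\<close> is a function in \<open>{1..n} \<rightarrow>\<^sub>E UNIV\<close>, so that \<open>n\<close> can be a
  term variable. A point \<open>x\<close> of \<open>\<real>\<^bsup>d 1\<^esup> \<times> \<dots> \<times> \<real>\<^bsup>d m\<^esup>\<close> is a function whose value \<open>x i\<close>,
  for \<open>i \<in> {1..m}\<close>, is the component in the \<open>i\<close>-th factor.\<close>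

text \<open>Half-open means \<open>[a, a + l)\<close> in every coordinate.\<close>

definition cube_of_side :: "nat \<Rightarrow> real \<Rightarrow> (nat \<Rightarrow> real) set \<Rightarrow> bool" where
  "cube_of_side n l Q \<longleftrightarrow> (\<exists>a. Q = (\<Pi>\<^sub>E j\<in>{1..n}. {a j ..< a j + l}))"

definition dyadic_grid :: "nat \<Rightarrow> (nat \<Rightarrow> real) set set \<Rightarrow> bool" where
  "dyadic_grid n D \<longleftrightarrow>
     (\<forall>Q\<in>D. \<exists>k::int. cube_of_side n (2 powi k) Q) \<and>
     (\<forall>k::int. partition_on ({1..n} \<rightarrow>\<^sub>E UNIV) {Q \<in> D. cube_of_side n (2 powi k) Q}) \<and>
     (\<forall>Q\<in>D. \<forall>R\<in>D. Q \<inter> R \<noteq> {} \<longrightarrow> Q \<subseteq> R \<or> R \<subseteq> Q)"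

text \<open>Lebesgue measure; the completion makes all Lebesgue measurable sets available.\<close>

definition lebesgue_prod :: "nat \<Rightarrow> (nat \<Rightarrow> nat) \<Rightarrow> (nat \<Rightarrow> nat \<Rightarrow> real) measure" where
  "lebesgue_prod m d = completion (\<Pi>\<^sub>M i\<in>{1..m}. \<Pi>\<^sub>M j\<in>{1..d i}. lborel)"

definition dyadic_rectangles ::
  "nat \<Rightarrow> (nat \<Rightarrow> (nat \<Rightarrow> real) set set) \<Rightarrow> (nat \<Rightarrow> nat \<Rightarrow> real) set set" where
  "dyadic_rectangles m D = {\<Pi>\<^sub>E i\<in>{1..m}. Q i | Q. \<forall>i\<in>{1..m}. Q i \<in> D i}"

text \<open>Tuples in \<open>\<int>\<^bsup>m - 1\<^esup>\<close> are functions in \<open>{1..m - 1} \<rightarrow>\<^sub>E UNIV\<close>.\<close>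

definition zygmund_rectangles ::
  "nat \<Rightarrow> (nat \<Rightarrow> nat) \<Rightarrow> (nat \<Rightarrow> (nat \<Rightarrow> real) set set) \<Rightarrow> ((nat \<Rightarrow> int) \<Rightarrow> int) \<Rightarrow>
    (nat \<Rightarrow> nat \<Rightarrow> real) set set" where
  "zygmund_rectangles m d D \<Phi> =
     {I \<in> dyadic_rectangles m D.
        \<exists>Q. \<exists>k \<in> {1..m - 1} \<rightarrow>\<^sub>E UNIV.
          I = (\<Pi>\<^sub>E i\<in>{1..m}. Q i) \<and>
          (\<forall>i\<in>{1..m - 1}. cube_of_side (d i) (2 powi k i) (Q i)) \<and>
          cube_of_side (d m) (2 powi \<Phi> k) (Q m)}"

definition counting_fun :: "'a set set \<Rightarrow> 'a \<Rightarrow> real" where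
  "counting_fun G x = (\<Sum>I\<in>G. indicator I x)"

definition incomparable :: "'a set set \<Rightarrow> bool" where
  "incomparable G \<longleftrightarrow> pairwise (\<lambda>I J. \<not> I \<subseteq> J) G"

definition sparse_family :: "'a measure \<Rightarrow> real \<Rightarrow> 'a set set \<Rightarrow> bool" where
  "sparse_family M \<eta> G \<longleftrightarrow>
     (\<exists>E. disjoint_family_on E G \<and>
       (\<forall>I\<in>G. E I \<in> sets M \<and> E I \<subseteq> I \<and> emeasure M (E I) \<ge> ennreal \<eta> * emeasure M I))"

end

theory Submission
  imports Defs
begin

text \<open>A nested Cantor type construction in each of the \<open>m - 1\<close> directions other than the second, with
  \<open>N\<close> generations of relative density \<open>2 ^ (- s d)\<close> (for cubes of dimension \<open>d\<close>), gives \<open>N ^ (m - 1)\<close>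
  product sets. All of them contain the product of the last generations, whose measure is only
  exponentially small in \<open>N\<close>. Each product set is partitioned into Zygmund rectangles. A tile may be long
  compared with the next generation while being a fraction of the present one, so that the next
  generation takes up a small proportion of every tile: this freedom in the choice of the tile makes it
  possible to use pairwise incomparable side lengths for distinct product sets and still have
  sparseness. Then \<open>h\<close> is at least \<open>N ^ (m - 1)\<close> on a set of measure \<open>exp (- C N)\<close>, and
  \<open>c N ^ ((m - 1) \<beta>)\<close> dominates \<open>C N\<close> as soon as \<open>(m - 1) \<beta> > 1\<close>.\<close>

subsection \<open>Dyadic cubes\<close>

text \<open>Otherwise the simplifier rewrites \<open>{1..n}\<close> to \<open>{Suc 0..n}\<close>.\<close>

declare One_nat_def [simp del]

lemma emeasure_cube_of_side:
  assumes "cube_of_side n l Q" "0 \<le> l"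
  shows "Q \<in> sets (\<Pi>\<^sub>M j\<in>{1..n}. lborel)"
    and "emeasure (\<Pi>\<^sub>M j\<in>{1..n}. lborel) Q = ennreal (l ^ n)"
proof -
  interpret product_sigma_finite "\<lambda>_::nat. lborel :: real measure"
    by standard
  from assms obtain a where Q: "Q = (\<Pi>\<^sub>E j\<in>{1..n}. {a j ..< a j + l})"
    by (auto simp: cube_of_side_def)
  show "Q \<in> sets (\<Pi>\<^sub>M j\<in>{1..n}. lborel)"
    unfolding Q by (intro sets_PiM_I_finite) auto
  have "emeasure (\<Pi>\<^sub>M j\<in>{1..n}. lborel) Q = (\<Prod>j\<in>{1..n}. emeasure lborel {a j ..< a j + l})"
    unfolding Q by (intro emeasure_PiM) auto
  also have "\<dots> = (\<Prod>j\<in>{1..n}. ennreal l)"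
    using assms by (intro prod.cong) auto
  also have "\<dots> = ennreal (l ^ n)"
    using assms by (simp add: ennreal_power)
  finally show "emeasure (\<Pi>\<^sub>M j\<in>{1..n}. lborel) Q = ennreal (l ^ n)" .
qed

lemma cube_of_side_nonempty: "cube_of_side n l Q \<Longrightarrow> 0 < l \<Longrightarrow> Q \<noteq> {}"
  by (auto simp: cube_of_side_def PiE_eq_empty_iff)

definition grid_level :: "nat \<Rightarrow> (nat \<Rightarrow> real) set set \<Rightarrow> int \<Rightarrow> (nat \<Rightarrow> real) set set" where
  "grid_level n D k = {Q \<in> D. cube_of_side n (2 powi k) Q}"

text \<open>Only the covering is demanded. The reverse inclusion is automatic, and in a dyadic grid
  cubes of one level are disjoint, so \<open>A\<close> is partitioned by its level-\<open>k\<close>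
  cubes.\<close>

definition tiled :: "nat \<Rightarrow> (nat \<Rightarrow> real) set set \<Rightarrow> int \<Rightarrow> (nat \<Rightarrow> real) set \<Rightarrow> bool" where
  "tiled n D k A \<longleftrightarrow> A \<subseteq> \<Union>{Q \<in> grid_level n D k. Q \<subseteq> A}"

lemma grid_level_measure:
  assumes "Q \<in> grid_level n D k"
  shows "Q \<in> sets (\<Pi>\<^sub>M j\<in>{1..n}. lborel)"
    and "emeasure (\<Pi>\<^sub>M j\<in>{1..n}. lborel) Q = ennreal ((2 powi k) ^ n)"
  using assms emeasure_cube_of_side[of n "2 powi k" Q] by (auto simp: grid_level_def)

lemma grid_level_nonempty: "Q \<in> grid_level n D k \<Longrightarrow> Q \<noteq> {}"
  using cube_of_side_nonempty[of n "2 powi k" Q] by (auto simp: grid_level_def)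

lemma tiledE:
  assumes "tiled n D k A" "x \<in> A"
  obtains Q where "Q \<in> grid_level n D k" "x \<in> Q" "Q \<subseteq> A"
  using assms unfolding tiled_def by blast

section \<open>Nesting, packing and tilings in a single dyadic grid\<close>

locale dyadic_cubes =
  fixes n :: nat and D :: "(nat \<Rightarrow> real) set set"
  assumes n_pos: "1 \<le> n" and grid: "dyadic_grid n D"
begin

abbreviation "vol \<equiv> emeasure (\<Pi>\<^sub>M j\<in>{1..n}. (lborel :: real measure))"

lemma level_disjoint:
  "\<lbrakk>Q \<in> grid_level n D k; R \<in> grid_level n D k; x \<in> Q; x \<in> R\<rbrakk> \<Longrightarrow> Q = R"
  using grid partition_onD2[of "{1..n} \<rightarrow>\<^sub>E UNIV" "grid_level n D k"]
  unfolding dyadic_grid_def grid_level_def[symmetric] disjoint_def by blast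

lemma level_cover:
  assumes "x \<in> {1..n} \<rightarrow>\<^sub>E UNIV"
  obtains Q where "Q \<in> grid_level n D k" "x \<in> Q"
  using assms grid partition_onD1[of "{1..n} \<rightarrow>\<^sub>E UNIV" "grid_level n D k"]
  unfolding dyadic_grid_def grid_level_def[symmetric] by blast

text \<open>Monotonicity of the measure compares the \<open>n\<close>-th powers of the sides;
  \<open>n_pos\<close> allows the roots to be taken.\<close>

lemma level_subset_le:
  assumes "Q \<in> grid_level n D k" "R \<in> grid_level n D k'" "Q \<subseteq> R"
  shows "k \<le> k'"
proof -
  have "vol Q \<le> vol R"
    using assms by (intro emeasure_mono) (auto dest: grid_level_measure)
  then have "(2 powi k :: real) ^ n \<le> (2 powi k') ^ n"
    using assms by (simp add: grid_level_measure)
  then have "(2 powi k :: real) \<le> 2 powi k'"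
    using n_pos by (subst (asm) power_mono_iff) auto
  then show ?thesis
    using power_int_strict_increasing[of k' k "2::real"] by (cases "k' < k") auto
qed

text \<open>The grid axiom leaves two possible inclusions; the wrong one forces equal levels, and
  intersecting cubes of one level coincide.\<close>

lemma level_nested:
  assumes "Q \<in> grid_level n D k" "R \<in> grid_level n D k'" "k \<le> k'" "x \<in> Q" "x \<in> R"
  shows "Q \<subseteq> R"
proof (cases "R \<subseteq> Q")
  case True
  then have "k = k'"
    using level_subset_le assms by force
  then show ?thesis
    using assms level_disjoint by blast
next
  case False
  then show ?thesis
    using assms grid unfolding dyadic_grid_def grid_level_def by blast
qed

lemma tiled_refine:
  assumes "tiled n D k A" "k' \<le> k"
  shows "tiled n D k' A"
  unfolding tiled_def
proof
  fix x assume "x \<in> A"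
  then obtain Q where Q: "Q \<in> grid_level n D k" "x \<in> Q" "Q \<subseteq> A"
    using assms tiledE by metis
  then have "x \<in> {1..n} \<rightarrow>\<^sub>E UNIV"
    by (auto simp: grid_level_def cube_of_side_def PiE_def)
  then obtain R where R: "R \<in> grid_level n D k'" "x \<in> R"
    by (rule level_cover)
  then have "R \<subseteq> Q"
    using level_nested Q assms by blast
  then show "x \<in> \<Union>{Q \<in> grid_level n D k'. Q \<subseteq> A}"
    using Q R by blast
qed

lemma level_tiled: "Q \<in> grid_level n D k \<Longrightarrow> k' \<le> k \<Longrightarrow> tiled n D k' Q"
  by (rule tiled_refine[of k]) (auto simp: tiled_def)

text \<open>A packing argument: the cubes are disjoint and of equal positive measure \<delta>, so
  sufficiently many of them would exceed the volume of \<open>A\<close>.\<close>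

lemma finite_level_subsets:
  assumes "A \<in> sets (\<Pi>\<^sub>M j\<in>{1..n}. lborel)" "vol A < \<infinity>"
  shows "finite {Q \<in> grid_level n D k. Q \<subseteq> A}"
proof (rule ccontr)
  assume inf: "infinite {Q \<in> grid_level n D k. Q \<subseteq> A}"
  define \<delta> :: real where "\<delta> = (2 powi k) ^ n"
  have "\<delta> > 0"
    by (simp add: \<delta>_def)
  obtain v where v: "vol A = ennreal v" "0 \<le> v"
    using assms(2) by (cases "vol A") auto
  obtain N :: nat where N: "v < real N * \<delta>"
    using reals_Archimedean3[OF \<open>\<delta> > 0\<close>] by blast
  obtain F where F: "finite F" "card F = N" "F \<subseteq> {Q \<in> grid_level n D k. Q \<subseteq> A}"
    using infinite_arbitrarily_large[OF inf, of N] by auto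
  have "ennreal (real N * \<delta>) = (\<Sum>Q\<in>F. ennreal \<delta>)"
    using F \<open>\<delta> > 0\<close> by (simp add: ennreal_mult ennreal_of_nat_eq_real_of_nat)
  also have "\<dots> = (\<Sum>Q\<in>F. vol Q)"
    using F by (intro sum.cong) (auto simp: \<delta>_def grid_level_measure)
  also have "\<dots> = vol (\<Union>Q\<in>F. Q)"
  proof (rule sum_emeasure)
    show "disjoint_family_on (\<lambda>Q. Q) F"
      unfolding disjoint_family_on_def using F(3) level_disjoint by blast
  qed (use F in \<open>auto simp: grid_level_measure\<close>)
  also have "\<dots> \<le> vol A"
    using F assms by (intro emeasure_mono) auto
  finally show False
    using N v \<open>\<delta> > 0\<close> by (simp add: ennreal_le_iff)
qed

text \<open>The map \<open>c\<close> is kept general because the lemma serves twice: with the chosen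
  descendants, and with \<open>c Q = Q\<close>.\<close>

lemma sum_vol_tiles:
  assumes "tiled n D k A" "A \<in> sets (\<Pi>\<^sub>M j\<in>{1..n}. lborel)" "vol A < \<infinity>"
    and "\<And>Q. Q \<in> grid_level n D k \<Longrightarrow> c Q \<in> sets (\<Pi>\<^sub>M j\<in>{1..n}. lborel)"
    and "\<And>Q. Q \<in> grid_level n D k \<Longrightarrow> c Q \<subseteq> Q"
  shows "vol (\<Union>Q\<in>{Q \<in> grid_level n D k. Q \<subseteq> A}. c Q) =
    (\<Sum>Q\<in>{Q \<in> grid_level n D k. Q \<subseteq> A}. vol (c Q))"
proof (rule sum_emeasure[symmetric])
  show "disjoint_family_on c {Q \<in> grid_level n D k. Q \<subseteq> A}"
    unfolding disjoint_family_on_def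
  proof (intro ballI impI)
    fix Q R assume QR: "Q \<in> {Q \<in> grid_level n D k. Q \<subseteq> A}" "R \<in> {Q \<in> grid_level n D k. Q \<subseteq> A}" "Q \<noteq> R"
    then have "Q \<inter> R = {}"
      using level_disjoint[of Q k R] by auto
    then show "c Q \<inter> c R = {}"
      using QR assms(5)[of Q] assms(5)[of R] by auto
  qed
qed (use assms(4) finite_level_subsets[OF assms(2,3)] in auto)

text \<open>\<open>B\<close> keeps one descendant, \<open>s\<close> generations down, of every cube of level \<open>k\<close> in \<open>A\<close>.\<close>

lemma thinning:
  fixes s :: nat
  assumes "tiled n D k A" "A \<in> sets (\<Pi>\<^sub>M j\<in>{1..n}. lborel)" "vol A < \<infinity>"
  obtains B where "B \<subseteq> A" "tiled n D (k - int s) B" "B \<in> sets (\<Pi>\<^sub>M j\<in>{1..n}. lborel)"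
    and "\<And>S. \<lbrakk>tiled n D k S; S \<subseteq> A; S \<in> sets (\<Pi>\<^sub>M j\<in>{1..n}. lborel)\<rbrakk>
      \<Longrightarrow> vol (S \<inter> B) = ennreal ((1/2) ^ (s * n)) * vol S"
proof -
  have "\<exists>R. R \<in> grid_level n D (k - int s) \<and> R \<subseteq> Q" if "Q \<in> grid_level n D k" for Q
  proof -
    have "tiled n D (k - int s) Q"
      by (rule level_tiled[OF that]) simp
    then show ?thesis
      using grid_level_nonempty[OF that] unfolding tiled_def by blast
  qed
  then obtain c where c: "\<And>Q. Q \<in> grid_level n D k \<Longrightarrow> c Q \<in> grid_level n D (k - int s)"
    "\<And>Q. Q \<in> grid_level n D k \<Longrightarrow> c Q \<subseteq> Q"
    by metis
  define B where "B = (\<Union>Q\<in>{Q \<in> grid_level n D k. Q \<subseteq> A}. c Q)"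
  have meas: "c Q \<in> sets (\<Pi>\<^sub>M j\<in>{1..n}. lborel)" if "Q \<in> grid_level n D k" for Q
    using c(1)[OF that] grid_level_measure by blast
  have cQ: "vol (c Q) = ennreal ((1/2) ^ (s * n)) * vol Q" if "Q \<in> grid_level n D k" for Q
  proof -
    have "(2 powi (k - int s) :: real) ^ n = (1/2) ^ (s * n) * (2 powi k) ^ n"
      by (simp add: power_int_diff power_divide power_mult)
    then show ?thesis
      using c(1)[OF that] that
      by (simp add: grid_level_measure ennreal_mult)
  qed
  show thesis
  proof (rule that[of B])
    show "B \<subseteq> A"
      using c(2) unfolding B_def by blast
    show "B \<in> sets (\<Pi>\<^sub>M j\<in>{1..n}. lborel)"
      unfolding B_def using finite_level_subsets[OF assms(2,3)] meas by (intro sets.finite_UN) auto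
    show "tiled n D (k - int s) B"
      using c(1) unfolding tiled_def B_def by blast
    fix S assume S: "tiled n D k S" "S \<subseteq> A" "S \<in> sets (\<Pi>\<^sub>M j\<in>{1..n}. lborel)"
    then have fin: "vol S < \<infinity>"
      using assms emeasure_mono[OF S(2) assms(2)] by (intro le_less_trans[OF _ assms(3)])
    \<comment> \<open>A point of \<open>S\<close> and \<open>B\<close> lies in some
      \<open>c Q\<close> and in a tile \<open>R\<close> of \<open>S\<close>. Both \<open>Q\<close>
      and \<open>R\<close> have level \<open>k\<close>, hence agree, so \<open>B\<close> meets
      \<open>S\<close> only in descendants of the tiles of \<open>S\<close>.\<close>
    have "S \<inter> B = (\<Union>Q\<in>{Q \<in> grid_level n D k. Q \<subseteq> S}. c Q)"
    proof (intro subset_antisym subsetI)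
      fix x assume x: "x \<in> S \<inter> B"
      then obtain Q where Q: "Q \<in> grid_level n D k" "x \<in> c Q"
        unfolding B_def by blast
      obtain R where R: "R \<in> grid_level n D k" "x \<in> R" "R \<subseteq> S"
        using S x tiledE by (metis IntD1)
      have "Q = R"
        using Q R c(2) level_disjoint by blast
      then show "x \<in> (\<Union>Q\<in>{Q \<in> grid_level n D k. Q \<subseteq> S}. c Q)"
        using Q R by blast
    next
      fix x assume "x \<in> (\<Union>Q\<in>{Q \<in> grid_level n D k. Q \<subseteq> S}. c Q)"
      then show "x \<in> S \<inter> B"
        using S c(2) unfolding B_def by blast
    qed
    then have "vol (S \<inter> B) = (\<Sum>Q\<in>{Q \<in> grid_level n D k. Q \<subseteq> S}. vol (c Q))"
      using sum_vol_tiles[OF S(1,3) fin meas c(2)] by simp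
    also have "\<dots> = ennreal ((1/2) ^ (s * n)) * (\<Sum>Q\<in>{Q \<in> grid_level n D k. Q \<subseteq> S}. vol Q)"
      by (simp add: cQ sum_distrib_left)
    also have "(\<Sum>Q\<in>{Q \<in> grid_level n D k. Q \<subseteq> S}. vol Q) = vol (\<Union>Q\<in>{Q \<in> grid_level n D k. Q \<subseteq> S}. Q)"
      using sum_vol_tiles[OF S(1,3) fin, of "\<lambda>Q. Q"] by (simp add: grid_level_measure)
    also have "(\<Union>Q\<in>{Q \<in> grid_level n D k. Q \<subseteq> S}. Q) = S"
      using S(1) unfolding tiled_def by blast
    finally show "vol (S \<inter> B) = ennreal ((1/2) ^ (s * n)) * vol S" .
  qed
qed

section \<open>Nested Cantor-type sets\<close>

lemma level_exists: obtains Q where "Q \<in> grid_level n D k"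
proof -
  have "(\<lambda>j\<in>{1..n}. 0) \<in> {1..n} \<rightarrow>\<^sub>E (UNIV :: real set)"
    by simp
  then show thesis
    by (rule level_cover) (rule that)
qed

text \<open>Each generation is refined from its own level \<open>\<alpha> p\<close> to the level
  \<open>\<beta> p\<close> and only then thinned. A cube inside it of level at least
  \<open>\<beta> p\<close> is a union of cubes of level \<open>\<beta> p\<close>, so it retains the
  same proportion. The gap between the two levels is the later room for choosing tiles.\<close>

lemma nested_thinning:
  fixes s :: nat and \<alpha> \<beta> :: "nat \<Rightarrow> int"
  assumes "\<And>p. \<beta> p \<le> \<alpha> p" "\<And>p. \<alpha> (Suc p) = \<beta> p - int s"
  shows "\<exists>A. \<forall>p. A (Suc p) \<subseteq> A p \<and> A p \<in> sets (\<Pi>\<^sub>M j\<in>{1..n}. lborel) \<and>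
    tiled n D (\<alpha> p) (A p) \<and>
    vol (A p) = ennreal ((1/2) ^ (s * n * p) * (2 powi \<alpha> 0) ^ n) \<and>
    (\<forall>k Q. \<beta> p \<le> k \<longrightarrow> Q \<in> grid_level n D k \<longrightarrow> Q \<subseteq> A p \<longrightarrow>
      vol (Q \<inter> A (Suc p)) = ennreal ((1/2) ^ (s * n)) * vol Q)"
    (is "\<exists>A. \<forall>p. ?Q A p")
proof -
  let ?M = "\<Pi>\<^sub>M j\<in>{1..n}. lborel :: real measure"
  define v where "v p = (1/2) ^ (s * n * p) * (2 powi \<alpha> 0 :: real) ^ n" for p
  \<comment> \<open>\<open>P\<close> is the invariant of one generation and \<open>R\<close> the
    relation between consecutive ones, in the form required by dependent choice.\<close>
  define P where "P p A \<longleftrightarrow> A \<in> sets ?M \<and> tiled n D (\<alpha> p) A \<and> vol A = ennreal (v p)" for p A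
  define R where "R p A B \<longleftrightarrow> B \<subseteq> A \<and> (\<forall>k Q. \<beta> p \<le> k \<longrightarrow> Q \<in> grid_level n D k \<longrightarrow> Q \<subseteq> A
      \<longrightarrow> vol (Q \<inter> B) = ennreal ((1/2) ^ (s * n)) * vol Q)" for p A B
  obtain Q0 where "Q0 \<in> grid_level n D (\<alpha> 0)"
    by (rule level_exists)
  then have "P 0 Q0"
    by (simp add: P_def v_def grid_level_measure level_tiled)
  moreover have "\<exists>B. P (Suc p) B \<and> R p A B" if "P p A" for p A
  proof -
    have A: "tiled n D (\<beta> p) A" "A \<in> sets ?M" "vol A < \<infinity>" "vol A = ennreal (v p)"
      using that assms(1) tiled_refine by (auto simp: P_def)
    from thinning[OF A(1-3), of s] obtain B where B: "B \<subseteq> A" "tiled n D (\<beta> p - int s) B" "B \<in> sets ?M"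
      "\<And>S. \<lbrakk>tiled n D (\<beta> p) S; S \<subseteq> A; S \<in> sets ?M\<rbrakk>
      \<Longrightarrow> vol (S \<inter> B) = ennreal ((1/2) ^ (s * n)) * vol S"
      by metis
    \<comment> \<open>Thinning applied to \<open>S = A\<close> itself gives the measure of the next
      generation.\<close>
    have "vol B = ennreal ((1/2) ^ (s * n)) * vol A"
      using B(4)[of A] A B(1) by (simp add: Int_absorb1)
    also have "\<dots> = ennreal (v (Suc p))"
      by (simp add: A(4) v_def power_add ennreal_mult[symmetric] mult.assoc)
    finally have "P (Suc p) B"
      using B assms(2) by (simp add: P_def)
    moreover have "R p A B"
      unfolding R_def using B(1,4) level_tiled grid_level_measure(1) by blast
    ultimately show ?thesis
      by blast
  qed
  ultimately obtain A where A: "\<And>p. P p (A p)" "\<And>p. R p (A p) (A (Suc p))"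
    using dependent_nat_choice[of P R] by blast
  show ?thesis
  proof (rule exI[of _ A], rule allI)
    show "?Q A p" for p
      using A(1)[of p] A(2)[of p] unfolding P_def R_def v_def
      by (elim conjE) (intro conjI; assumption)
  qed
qed

end

subsection \<open>Tilings by Zygmund rectangles\<close>

abbreviation rectangle_space :: "nat \<Rightarrow> (nat \<Rightarrow> nat) \<Rightarrow> (nat \<Rightarrow> nat \<Rightarrow> real) measure" where
  "rectangle_space m d \<equiv> (\<Pi>\<^sub>M i\<in>{1..m}. \<Pi>\<^sub>M j\<in>{1..d i}. lborel)"

lemma PiE_in_rectangle_space:
  assumes "\<And>i. i \<in> {1..m} \<Longrightarrow> A i \<in> sets (\<Pi>\<^sub>M j\<in>{1..d i}. lborel)"
  shows "(\<Pi>\<^sub>E i\<in>{1..m}. A i) \<in> sets (rectangle_space m d)"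
    and "(\<Pi>\<^sub>E i\<in>{1..m}. A i) \<in> sets (lebesgue_prod m d)"
proof -
  show *: "(\<Pi>\<^sub>E i\<in>{1..m}. A i) \<in> sets (rectangle_space m d)"
    using assms by (intro sets_PiM_I_finite) auto
  then show "(\<Pi>\<^sub>E i\<in>{1..m}. A i) \<in> sets (lebesgue_prod m d)"
    unfolding lebesgue_prod_def by (rule sets_completionI_sets)
qed

lemma emeasure_lebesgue_prod:
  assumes "\<And>i. i \<in> {1..m} \<Longrightarrow> A i \<in> sets (\<Pi>\<^sub>M j\<in>{1..d i}. lborel)"
  shows "emeasure (lebesgue_prod m d) (\<Pi>\<^sub>E i\<in>{1..m}. A i) =
    (\<Prod>i\<in>{1..m}. emeasure (\<Pi>\<^sub>M j\<in>{1..d i}. lborel) (A i))"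
proof -
  interpret lb: product_sigma_finite "\<lambda>_::nat. lborel :: real measure"
    by standard
  interpret product_sigma_finite "\<lambda>i. \<Pi>\<^sub>M j\<in>{1..d i}. (lborel :: real measure)"
    by (intro product_sigma_finite.intro lb.sigma_finite) auto
  have "emeasure (lebesgue_prod m d) (\<Pi>\<^sub>E i\<in>{1..m}. A i) =
      emeasure (rectangle_space m d) (\<Pi>\<^sub>E i\<in>{1..m}. A i)"
    unfolding lebesgue_prod_def using PiE_in_rectangle_space(1)[OF assms] by simp
  also have "\<dots> = (\<Prod>i\<in>{1..m}. emeasure (\<Pi>\<^sub>M j\<in>{1..d i}. lborel) (A i))"
    using assms by (intro emeasure_PiM) auto
  finally show ?thesis .
qed

lemma emeasure_Diff_ge:
  assumes "Q \<in> sets M" "B \<in> sets M" "emeasure M Q < \<infinity>" "0 \<le> \<epsilon>" "\<epsilon> \<le> 1"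
    and "emeasure M (Q \<inter> B) \<le> ennreal \<epsilon> * emeasure M Q"
  shows "ennreal (1 - \<epsilon>) * emeasure M Q \<le> emeasure M (Q - B)"
proof -
  obtain q where q: "emeasure M Q = ennreal q" "0 \<le> q"
    using assms(3) by (cases "emeasure M Q") auto
  have "emeasure M (Q \<inter> B) \<le> ennreal (\<epsilon> * q)"
    using assms q by (simp add: ennreal_mult)
  then obtain r where r: "emeasure M (Q \<inter> B) = ennreal r" "0 \<le> r" "r \<le> \<epsilon> * q"
    using assms(4) q by (cases "emeasure M (Q \<inter> B)") (auto simp: ennreal_le_iff top_unique)
  have "emeasure M (Q - B) = emeasure M (Q - Q \<inter> B)"
    by (rule arg_cong[where f="emeasure M"]) auto
  also have "\<dots> = emeasure M Q - emeasure M (Q \<inter> B)"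
    using assms r by (intro emeasure_Diff) auto
  also have "\<dots> = ennreal (q - r)"
    using q r by (simp add: ennreal_minus)
  finally have "emeasure M (Q - B) = ennreal (q - r)" .
  then show ?thesis
    using q r assms by (simp add: ennreal_mult[symmetric] algebra_simps ennreal_leI)
qed

text \<open>An index \<open>l\<close> stands for the set with factors \<open>A i (l i)\<close>, to be cut into congruent rectangles of
  sides \<open>2 powi \<kappa> l i\<close>. These cubes being coarser than the passage from \<open>A i (l i)\<close> to the next
  generation, each of them keeps most of its measure outside that generation, which yields
  sparseness; the antichain condition yields incomparability.\<close>

locale zygmund_tiling =
  fixes m :: nat and d :: "nat \<Rightarrow> nat" and D :: "nat \<Rightarrow> (nat \<Rightarrow> real) set set"
    and \<Phi> :: "(nat \<Rightarrow> int) \<Rightarrow> int" and L :: "(nat \<Rightarrow> nat) set"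
    and \<kappa> :: "(nat \<Rightarrow> nat) \<Rightarrow> nat \<Rightarrow> int" and A :: "nat \<Rightarrow> nat \<Rightarrow> (nat \<Rightarrow> real) set"
    and \<epsilon> :: real
  assumes m_ge: "2 \<le> m"
    and grids: "\<And>i. i \<in> {1..m} \<Longrightarrow> dyadic_cubes (d i) (D i)"
    and finite_L: "finite L"
    and L_separated: "\<And>l l'. \<lbrakk>l \<in> L; l' \<in> L; l \<noteq> l'\<rbrakk> \<Longrightarrow> \<exists>i\<in>{1..m}. l i \<noteq> l' i"
    and antichain: "\<And>l l'. \<lbrakk>l \<in> L; l' \<in> L; l \<noteq> l'\<rbrakk> \<Longrightarrow> \<exists>i\<in>{1..m}. \<kappa> l i < \<kappa> l' i"
    and decreasing: "\<And>i p. i \<in> {1..m} \<Longrightarrow> A i (Suc p) \<subseteq> A i p"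
    and measurable_A: "\<And>i p. i \<in> {1..m} \<Longrightarrow> A i p \<in> sets (\<Pi>\<^sub>M j\<in>{1..d i}. lborel)"
    and finite_A: "\<And>i p. i \<in> {1..m} \<Longrightarrow> emeasure (\<Pi>\<^sub>M j\<in>{1..d i}. lborel) (A i p) < \<infinity>"
    and tiled_A: "\<And>l i. \<lbrakk>l \<in> L; i \<in> {1..m}\<rbrakk> \<Longrightarrow> tiled (d i) (D i) (\<kappa> l i) (A i (l i))"
    and \<epsilon>: "0 \<le> \<epsilon>" "\<epsilon> \<le> 1"
    and thin: "\<And>l i Q. \<lbrakk>l \<in> L; i \<in> {1..m}; Q \<in> grid_level (d i) (D i) (\<kappa> l i); Q \<subseteq> A i (l i)\<rbrakk>
      \<Longrightarrow> emeasure (\<Pi>\<^sub>M j\<in>{1..d i}. lborel) (Q \<inter> A i (Suc (l i)))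
        \<le> ennreal \<epsilon> * emeasure (\<Pi>\<^sub>M j\<in>{1..d i}. lborel) Q"
    and zygmund: "\<And>l. l \<in> L \<Longrightarrow> \<kappa> l m = \<Phi> (restrict (\<kappa> l) {1..m - 1})"
begin

section \<open>The family of tiles and its incomparability\<close>

definition tiles :: "(nat \<Rightarrow> nat) \<Rightarrow> (nat \<Rightarrow> nat \<Rightarrow> real) set set" where
  "tiles l = PiE {1..m} ` (\<Pi>\<^sub>E i\<in>{1..m}. {Q \<in> grid_level (d i) (D i) (\<kappa> l i). Q \<subseteq> A i (l i)})"

definition family :: "(nat \<Rightarrow> nat \<Rightarrow> real) set set" where
  "family = (\<Union>l\<in>L. tiles l)"

lemma tilesE:
  assumes "I \<in> tiles l"
  obtains Q where "I = PiE {1..m} Q"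
    and "\<And>i. i \<in> {1..m} \<Longrightarrow> Q i \<in> grid_level (d i) (D i) (\<kappa> l i)"
    and "\<And>i. i \<in> {1..m} \<Longrightarrow> Q i \<subseteq> A i (l i)"
  using assms unfolding tiles_def by (auto simp: PiE_iff)

lemma finite_family: "finite family"
  unfolding family_def tiles_def
proof (intro finite_UN_I finite_L finite_imageI finite_PiE)
  fix l i assume "i \<in> {1..m}"
  then show "finite {Q \<in> grid_level (d i) (D i) (\<kappa> l i). Q \<subseteq> A i (l i)}"
    by (intro dyadic_cubes.finite_level_subsets grids measurable_A finite_A)
qed auto

lemma Union_tiles:
  assumes "l \<in> L"
  shows "\<Union>(tiles l) = (\<Pi>\<^sub>E i\<in>{1..m}. A i (l i))"
proof (intro subset_antisym subsetI)
  fix x assume "x \<in> \<Union>(tiles l)"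
  then obtain I where I: "I \<in> tiles l" "x \<in> I"
    by blast
  then obtain Q where "I = PiE {1..m} Q" "\<And>i. i \<in> {1..m} \<Longrightarrow> Q i \<subseteq> A i (l i)"
    using tilesE by metis
  then show "x \<in> (\<Pi>\<^sub>E i\<in>{1..m}. A i (l i))"
    using PiE_mono[of "{1..m}" Q "\<lambda>i. A i (l i)"] I by auto
next
  fix x assume x: "x \<in> (\<Pi>\<^sub>E i\<in>{1..m}. A i (l i))"
  have "\<exists>Q. Q \<in> grid_level (d i) (D i) (\<kappa> l i) \<and> x i \<in> Q \<and> Q \<subseteq> A i (l i)" if "i \<in> {1..m}" for i
    using tiledE[OF tiled_A[OF assms that], of "x i"] PiE_mem[OF x that] by metis
  then obtain Q where Q: "\<And>i. i \<in> {1..m} \<Longrightarrow>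
      Q i \<in> grid_level (d i) (D i) (\<kappa> l i) \<and> x i \<in> Q i \<and> Q i \<subseteq> A i (l i)"
    by metis
  have "PiE {1..m} (restrict Q {1..m}) \<in> tiles l"
    unfolding tiles_def
  proof (intro imageI PiE_I)
    show "restrict Q {1..m} i \<in> {Q \<in> grid_level (d i) (D i) (\<kappa> l i). Q \<subseteq> A i (l i)}" if "i \<in> {1..m}" for i
      using Q[OF that] that by simp
  qed (auto simp: restrict_def)
  moreover have "x \<in> PiE {1..m} (restrict Q {1..m})"
    using Q x by (auto simp: PiE_iff)
  ultimately show "x \<in> \<Union>(tiles l)"
    by blast
qed

lemma tile_nonempty: "I \<in> tiles l \<Longrightarrow> I \<noteq> {}"
  using grid_level_nonempty by (elim tilesE) (metis PiE_eq_empty_iff)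

text \<open>Inclusion of nonempty products passes to the factors and so orders all side lengths,
  which the antichain condition excludes for distinct indices. With equal indices, the factors are
  intersecting cubes of one level.\<close>

lemma tile_subset_imp_eq:
  assumes "l \<in> L" "l' \<in> L" "I \<in> tiles l" "J \<in> tiles l'" "I \<subseteq> J"
  shows "l = l'" and "I = J"
proof -
  from assms(3) obtain Q where Q: "I = PiE {1..m} Q"
    "\<And>i. i \<in> {1..m} \<Longrightarrow> Q i \<in> grid_level (d i) (D i) (\<kappa> l i)"
    using tilesE by metis
  from assms(4) obtain R where R: "J = PiE {1..m} R"
    "\<And>i. i \<in> {1..m} \<Longrightarrow> R i \<in> grid_level (d i) (D i) (\<kappa> l' i)"
    using tilesE by metis
  have sub: "Q i \<subseteq> R i" if "i \<in> {1..m}" for i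
    using assms(5) tile_nonempty[OF assms(3)] that unfolding Q(1) R(1) subset_PiE by blast
  then have "\<kappa> l i \<le> \<kappa> l' i" if "i \<in> {1..m}" for i
    using dyadic_cubes.level_subset_le[OF grids[OF that] Q(2)[OF that] R(2)[OF that]] that by blast
  then show "l = l'"
    using antichain[OF assms(2,1)] by (metis linorder_not_le)
  have "Q i = R i" if i: "i \<in> {1..m}" for i
  proof -
    obtain x where "x \<in> Q i"
      using grid_level_nonempty Q(2)[OF i] by blast
    then show ?thesis
      using dyadic_cubes.level_disjoint[OF grids[OF i] Q(2)[OF i]] R(2)[OF i] sub[OF i] \<open>l = l'\<close> by blast
  qed
  then show "I = J"
    unfolding Q(1) R(1) by (rule PiE_cong)
qed

lemma tiles_disjoint:
  assumes "I \<in> tiles l" "J \<in> tiles l" "x \<in> I" "x \<in> J"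
  shows "I = J"
proof -
  from assms(1) obtain Q where Q: "I = PiE {1..m} Q"
    "\<And>i. i \<in> {1..m} \<Longrightarrow> Q i \<in> grid_level (d i) (D i) (\<kappa> l i)"
    using tilesE by metis
  from assms(2) obtain R where R: "J = PiE {1..m} R"
    "\<And>i. i \<in> {1..m} \<Longrightarrow> R i \<in> grid_level (d i) (D i) (\<kappa> l i)"
    using tilesE by metis
  have "Q i = R i" if i: "i \<in> {1..m}" for i
    using dyadic_cubes.level_disjoint[OF grids[OF i] Q(2)[OF i] R(2)[OF i], of "x i"] assms(3,4) i
    unfolding Q(1) R(1) by (auto simp: PiE_iff)
  then show ?thesis
    unfolding Q(1) R(1) by (rule PiE_cong)
qed

lemma incomparable_family: "incomparable family"
  unfolding incomparable_def pairwise_def family_def using tile_subset_imp_eq(2) by blast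

lemma family_zygmund: "family \<subseteq> zygmund_rectangles m d D \<Phi>"
proof
  fix I assume "I \<in> family"
  then obtain l where l: "l \<in> L" "I \<in> tiles l"
    by (auto simp: family_def)
  then obtain Q where Q: "I = PiE {1..m} Q"
    "\<And>i. i \<in> {1..m} \<Longrightarrow> Q i \<in> D i \<and> cube_of_side (d i) (2 powi \<kappa> l i) (Q i)"
    using tilesE unfolding grid_level_def mem_Collect_eq by metis
  have "I \<in> dyadic_rectangles m D"
    unfolding dyadic_rectangles_def using Q by blast
  moreover have "\<forall>i\<in>{1..m - 1}. cube_of_side (d i) (2 powi restrict (\<kappa> l) {1..m - 1} i) (Q i)"
    using Q(2) by auto
  moreover have "cube_of_side (d m) (2 powi \<Phi> (restrict (\<kappa> l) {1..m - 1})) (Q m)"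
    using Q(2)[of m] m_ge zygmund[OF l(1)] by auto
  moreover have "restrict (\<kappa> l) {1..m - 1} \<in> {1..m - 1} \<rightarrow>\<^sub>E UNIV"
    by simp
  ultimately show "I \<in> zygmund_rectangles m d D \<Phi>"
    unfolding zygmund_rectangles_def using Q(1) by blast
qed

section \<open>Sparseness and the lower bound for the counting function\<close>

lemma antimono_A: "i \<in> {1..m} \<Longrightarrow> p \<le> q \<Longrightarrow> A i q \<subseteq> A i p"
  using lift_Suc_antimono_le[of "A i"] decreasing by blast

text \<open>The points whose component in every direction \<open>i\<close> leaves the nested
  sequence right after generation \<open>l i\<close>. The generation of departure is unique, which
  separates the cores of distinct indices.\<close>

definition core :: "(nat \<Rightarrow> nat) \<Rightarrow> (nat \<Rightarrow> nat \<Rightarrow> real) set" where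
  "core l = (\<Pi>\<^sub>E i\<in>{1..m}. A i (l i) - A i (Suc (l i)))"

lemma core_disjoint:
  assumes "l \<in> L" "l' \<in> L" "l \<noteq> l'"
  shows "core l \<inter> core l' = {}"
proof -
  obtain i where i: "i \<in> {1..m}" "l i \<noteq> l' i"
    using L_separated[OF assms] by blast
  have "A i (l' i) \<subseteq> A i (Suc (l i)) \<or> A i (l i) \<subseteq> A i (Suc (l' i))"
    using antimono_A[OF i(1)] i(2) by (metis Suc_leI linorder_neqE_nat)
  then show ?thesis
    using i(1) unfolding core_def PiE_iff by blast
qed

text \<open>The intersection is again a product, with factors \<open>Q i - A i (Suc (l i))\<close>.
  By \<open>thin\<close> each factor keeps the proportion \<open>1 - \<epsilon>\<close>, whence the
  \<open>m\<close>-th power.\<close>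

lemma tile_core:
  assumes "l \<in> L" "I \<in> tiles l"
  shows "I \<inter> core l \<in> sets (lebesgue_prod m d)"
    and "emeasure (lebesgue_prod m d) (I \<inter> core l) \<ge> ennreal ((1 - \<epsilon>) ^ m) * emeasure (lebesgue_prod m d) I"
proof -
  from assms(2) obtain Q where Q: "I = PiE {1..m} Q"
    "\<And>i. i \<in> {1..m} \<Longrightarrow> Q i \<in> grid_level (d i) (D i) (\<kappa> l i)"
    "\<And>i. i \<in> {1..m} \<Longrightarrow> Q i \<subseteq> A i (l i)"
    using tilesE by metis
  have eq: "I \<inter> core l = (\<Pi>\<^sub>E i\<in>{1..m}. Q i - A i (Suc (l i)))"
    unfolding Q(1) core_def PiE_Int 
    by (intro PiE_cong) (use Q(3) in blast)
  have meas: "Q i - A i (Suc (l i)) \<in> sets (\<Pi>\<^sub>M j\<in>{1..d i}. lborel)" if "i \<in> {1..m}" for i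
    using grid_level_measure(1)[OF Q(2)[OF that]] measurable_A[OF that] by blast
  show "I \<inter> core l \<in> sets (lebesgue_prod m d)"
    unfolding eq using meas by (rule PiE_in_rectangle_space)
  have "ennreal ((1 - \<epsilon>) ^ m) * emeasure (lebesgue_prod m d) I
      = (\<Prod>i\<in>{1..m}. ennreal (1 - \<epsilon>) * emeasure (\<Pi>\<^sub>M j\<in>{1..d i}. lborel) (Q i))"
    unfolding Q(1) using grid_level_measure(1)[OF Q(2)] \<epsilon>
    by (subst emeasure_lebesgue_prod) (auto simp: prod.distrib ennreal_power)
  also have "\<dots> \<le> (\<Prod>i\<in>{1..m}. emeasure (\<Pi>\<^sub>M j\<in>{1..d i}. lborel) (Q i - A i (Suc (l i))))"
  proof (intro prod_mono_ennreal emeasure_Diff_ge \<epsilon>)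
    fix i assume i: "i \<in> {1..m}"
    show "emeasure (\<Pi>\<^sub>M j\<in>{1..d i}. lborel) (Q i \<inter> A i (Suc (l i)))
        \<le> ennreal \<epsilon> * emeasure (\<Pi>\<^sub>M j\<in>{1..d i}. lborel) (Q i)"
      using thin[OF assms(1) i Q(2)[OF i] Q(3)[OF i]] .
  qed (use grid_level_measure[OF Q(2)] measurable_A in auto)
  also have "\<dots> = emeasure (lebesgue_prod m d) (I \<inter> core l)"
    unfolding eq using meas by (rule emeasure_lebesgue_prod[symmetric])
  finally show "emeasure (lebesgue_prod m d) (I \<inter> core l) \<ge> ennreal ((1 - \<epsilon>) ^ m) * emeasure (lebesgue_prod m d) I" .
qed

text \<open>The witness for a tile is its part in the core of its index: tiles with a common index
  are disjoint, and for different indices the cores are.\<close>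

lemma sparse_family_family: "sparse_family (lebesgue_prod m d) ((1 - \<epsilon>) ^ m) family"
proof -
  have "\<exists>l. l \<in> L \<and> I \<in> tiles l" if "I \<in> family" for I
    using that by (auto simp: family_def)
  then obtain lev where lev: "\<And>I. I \<in> family \<Longrightarrow> lev I \<in> L" "\<And>I. I \<in> family \<Longrightarrow> I \<in> tiles (lev I)"
    by metis
  show ?thesis
    unfolding sparse_family_def
  proof (intro exI[of _ "\<lambda>I. I \<inter> core (lev I)"] conjI ballI)
    show "disjoint_family_on (\<lambda>I. I \<inter> core (lev I)) family"
      unfolding disjoint_family_on_def
    proof (intro ballI impI)
      fix I J assume IJ: "I \<in> family" "J \<in> family" "I \<noteq> J"
      show "I \<inter> core (lev I) \<inter> (J \<inter> core (lev J)) = {}"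
      proof (cases "lev I = lev J")
        case True
        then have "I \<inter> J = {}"
          using tiles_disjoint[of I "lev I" J] lev(2)[OF IJ(1)] lev(2)[OF IJ(2)] IJ(3) by auto
        then show ?thesis
          by blast
      next
        case False
        then show ?thesis
          using core_disjoint[OF lev(1)[OF IJ(1)] lev(1)[OF IJ(2)]] by blast
      qed
    qed
  qed (use tile_core[OF lev] in auto)
qed

text \<open>Every index contributes a tile containing \<open>x\<close>, and a tile determines its
  index, so these tiles are distinct.\<close>

lemma counting_fun_family_ge:
  assumes "\<And>l. l \<in> L \<Longrightarrow> x \<in> (\<Pi>\<^sub>E i\<in>{1..m}. A i (l i))"
  shows "real (card L) \<le> counting_fun family x"
proof -
  have "\<exists>I. I \<in> tiles l \<and> x \<in> I" if "l \<in> L" for l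
    using assms[OF that] Union_tiles[OF that] by blast
  then obtain T where T: "\<And>l. l \<in> L \<Longrightarrow> T l \<in> tiles l" "\<And>l. l \<in> L \<Longrightarrow> x \<in> T l"
    by metis
  have "inj_on T L"
    using T(1) tile_subset_imp_eq(1) by (metis inj_onI subset_refl)
  then have "real (card L) = (\<Sum>I\<in>T ` L. indicator I x)"
    using T(2) by (simp add: sum.reindex)
  also have "\<dots> \<le> counting_fun family x"
    unfolding counting_fun_def using T(1) finite_family
    by (intro sum_mono2) (auto simp: family_def)
  finally show ?thesis .
qed

end

subsection \<open>The choice of the scales\<close>

text \<open>This isolates the geometry. \<open>H\<close> is what the analytic part uses: a set with
  large \<open>h\<close> whose measure is only exponentially small in \<open>N\<close>. The
  parameter \<open>s\<close> governs the sparseness and does not depend on \<open>N\<close>.\<close>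

lemma zygmund_family_exists:
  fixes m N s :: nat and d :: "nat \<Rightarrow> nat"
    and D :: "nat \<Rightarrow> (nat \<Rightarrow> real) set set" and \<Phi> :: "(nat \<Rightarrow> int) \<Rightarrow> int"
  assumes m: "m \<ge> 3"
    and d: "\<And>i. i \<in> {1..m} \<Longrightarrow> d i \<ge> 1"
    and D: "\<And>i. i \<in> {1..m} \<Longrightarrow> dyadic_grid (d i) (D i)"
    and \<Phi>: "\<And>k. k \<in> {1..m - 1} \<rightarrow>\<^sub>E UNIV \<Longrightarrow> \<Phi> k = (\<Sum>i=1..m - 1. k i)"
    and N: "1 \<le> N"
  shows "\<exists>G H. finite G \<and> G \<subseteq> zygmund_rectangles m d D \<Phi> \<and> incomparable G \<and>
    sparse_family (lebesgue_prod m d) ((1 - (1/2) ^ s) ^ m) G \<and>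
    emeasure (lebesgue_prod m d) (\<Union>G) = 1 \<and>
    H \<in> sets (lebesgue_prod m d) \<and> H \<subseteq> \<Union>G \<and>
    ennreal ((1/2) ^ (s * (\<Sum>i=1..m. d i) * N)) \<le> emeasure (lebesgue_prod m d) H \<and>
    (\<forall>x\<in>H. real (N ^ (m - 1)) \<le> counting_fun G x)"
proof -
  \<comment> \<open>Direction 2 stays at generation 0; the other \<open>m - 1\<close> directions run
    through \<open>N\<close> generations each.\<close>
  define L where "L = (\<Pi>\<^sub>E i\<in>{1..m}. if i = 2 then {0} else {..<N})"
  define M where "M = card L"
  have finL: "finite L"
    unfolding L_def by (intro finite_PiE) auto
  have "card L = (\<Prod>i\<in>{1..m}. if i = 2 then 1 else N)"
    unfolding L_def by (subst card_PiE) (auto intro!: prod.cong)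
  also have "\<dots> = N ^ (m - 1)"
    using m by (subst prod.remove[of _ 2]) (auto simp: card_Diff_singleton)
  finally have cardL: "card L = N ^ (m - 1)" .
  have L_less: "l i < N" and L_2: "l 2 = 0" if "l \<in> L" "i \<in> {1..m}" for l i
    using PiE_mem[OF that[unfolded L_def]] PiE_mem[OF that(1)[unfolded L_def], of 2] m N
    by (auto split: if_splits)
  obtain g where g: "bij_betw g L {0..<M}"
    using ex_bij_betw_finite_nat[OF finL] M_def by blast
  have g_less: "g l < M" if "l \<in> L" for l
    using bij_betw_apply[OF g that] by simp
  \<comment> \<open>Since \<open>g l < M\<close>, the indices with \<open>l 1 = p\<close> have their
    values of \<open>e\<close> in the block from \<open>M * p\<close> to
    \<open>M * p + M - 1\<close>; the residue modulo \<open>M\<close> recovers \<open>g l\<close>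
    and makes \<open>e\<close> injective.\<close>
  define e where "e l = M * l 1 + g l" for l
  have e_inj: "e l \<noteq> e l'" if "l \<in> L" "l' \<in> L" "l \<noteq> l'" for l l'
  proof
    assume "e l = e l'"
    then have "e l mod M = e l' mod M"
      by simp
    then have "g l = g l'"
      using g_less that by (simp add: e_def)
    then show False
      using that bij_betw_imp_inj_on[OF g] by (auto dest: inj_onD)
  qed
  have e_less: "e l < M * N" if "l \<in> L" for l
  proof -
    have "e l < M * Suc (l 1)"
      using g_less[OF that] by (simp add: e_def)
    also have "\<dots> \<le> M * N"
      using L_less[OF that, of 1] m by (intro mult_le_mono2) auto
    finally show ?thesis .
  qed

  txt \<open>Direction 1 shrinks and direction 2 grows along the lexicographic enumeration \<open>e\<close>, in steps \<open>W\<close>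
    that exceed the total variation of all other scales, so the scales form an antichain. In direction 1
    the generation \<open>A 1 (Suc p)\<close> is finer than all the scales used for \<open>l 1 = p\<close>; in the directions
    \<open>i \<ge> 3\<close> the \<open>A i p\<close> are nested cubes and serve as tiles themselves; direction 2, where only
    \<open>A 2 0\<close> is used, absorbs the Zygmund constraint. The parameter \<open>t\<close> makes \<open>A 2 0\<close> large enough to
    hold the tiles, at the expense of direction \<open>m\<close>, so as to keep the total measure equal to 1.\<close>
  define W where "W = s * (N * (m + 1)) + s + 1"
  define t where "t = W * (M * N) + s * (N * m)"
  \<comment> \<open>The levels in directions 2 and \<open>m\<close> are weighted by each other's
    dimension, so their contributions \<open>2 ^ (d m * t * d 2)\<close> and
    \<open>2 ^ (- (d 2 * t * d m))\<close> to the total measure cancel.\<close>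
  define \<alpha>\<^sub>0 :: "nat \<Rightarrow> int" where
    "\<alpha>\<^sub>0 i = (if i = 2 then int (d m * t) else if i = m then - int (d 2 * t) else 0)" for i
  \<comment> \<open>\<open>B i\<close> is the depth below \<open>\<alpha> i p\<close> available to
    tiles. In direction 1 the drop per generation, \<open>B 1 + s\<close>, is \<open>W * M\<close>,
    the length of one block of \<open>e\<close>; in direction 2 it reaches down to
    \<open>- int (d 2 * t) - int (s * N)\<close>, a lower bound for all scales used there.\<close>
  define B :: "nat \<Rightarrow> int" where
    "B i = (if i = 1 then int (W * M) - int s
      else if i = 2 then int (d m * t) + int (d 2 * t) + int (s * N) else 0)" for i
  define S where "S l = (\<Sum>i=3..m - 1. s * l i)" for l :: "nat \<Rightarrow> nat"
  \<comment> \<open>The value in direction 2 is obtained by solving the Zygmund equation for it, the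
    scales in all other directions being prescribed.\<close>
  define \<kappa> :: "(nat \<Rightarrow> nat) \<Rightarrow> nat \<Rightarrow> int" where
    "\<kappa> l i = (if i = 1 then - int (W * e l)
      else if i = 2 then int (W * e l) + int (S l) - int (d 2 * t) - int (s * l m)
      else \<alpha>\<^sub>0 i - int (s * l i))" for l i
  define \<alpha> where "\<alpha> i p = \<alpha>\<^sub>0 i - int p * (B i + int s)" for i p
  define \<epsilon> :: real where "\<epsilon> = (1/2) ^ s"
  have M_pos: "1 \<le> M"
    using cardL N by (simp add: M_def)
  have B_nonneg: "0 \<le> B i" for i
  proof -
    have "s * 1 \<le> W * M"
      using M_pos by (intro mult_le_mono) (auto simp: W_def)
    then show ?thesis
      by (auto simp: B_def simp flip: of_nat_mult)
  qed
  have S_le: "S l \<le> s * (N * m)" if "l \<in> L" for l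
  proof -
    have "S l \<le> (\<Sum>i=3..m - 1. s * N)"
      unfolding S_def using L_less[OF that] by (intro sum_mono mult_le_mono2) (auto simp: less_imp_le)
    also have "\<dots> = (m - 3) * (s * N)"
      using m by (simp add: Suc_diff_Suc numeral_3_eq_3)
    also have "\<dots> \<le> m * (s * N)"
      by (intro mult_le_mono1) simp
    finally show ?thesis
      by (simp add: ac_simps)
  qed
  have sl_le: "s * l i \<le> s * N" if "l \<in> L" "i \<in> {1..m}" for l i
    using L_less[OF that] by (intro mult_le_mono2) simp
  have dt_ge: "t \<le> d m * t"
    using d[of m] m by (cases "d m") auto

  have "\<forall>i\<in>{1..m}. \<exists>A. \<forall>p. A (Suc p) \<subseteq> A p \<and> A p \<in> sets (\<Pi>\<^sub>M j\<in>{1..d i}. lborel) \<and>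
      tiled (d i) (D i) (\<alpha> i p) (A p) \<and>
      emeasure (\<Pi>\<^sub>M j\<in>{1..d i}. lborel) (A p) = ennreal ((1/2) ^ (s * d i * p) * (2 powi \<alpha> i 0) ^ d i) \<and>
      (\<forall>k Q. \<alpha> i p - B i \<le> k \<longrightarrow> Q \<in> grid_level (d i) (D i) k \<longrightarrow> Q \<subseteq> A p \<longrightarrow>
        emeasure (\<Pi>\<^sub>M j\<in>{1..d i}. lborel) (Q \<inter> A (Suc p)) =
          ennreal ((1/2) ^ (s * d i)) * emeasure (\<Pi>\<^sub>M j\<in>{1..d i}. lborel) Q)"
  proof (intro ballI dyadic_cubes.nested_thinning)
    fix i assume i: "i \<in> {1..m}"
    show "dyadic_cubes (d i) (D i)"
      using d[OF i] D[OF i] by unfold_locales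
  qed (use B_nonneg in \<open>simp_all add: \<alpha>_def algebra_simps\<close>)
  then obtain A where A: "\<forall>i\<in>{1..m}. \<forall>p. A i (Suc p) \<subseteq> A i p \<and> A i p \<in> sets (\<Pi>\<^sub>M j\<in>{1..d i}. lborel) \<and>
      tiled (d i) (D i) (\<alpha> i p) (A i p) \<and>
      emeasure (\<Pi>\<^sub>M j\<in>{1..d i}. lborel) (A i p) = ennreal ((1/2) ^ (s * d i * p) * (2 powi \<alpha> i 0) ^ d i) \<and>
      (\<forall>k Q. \<alpha> i p - B i \<le> k \<longrightarrow> Q \<in> grid_level (d i) (D i) k \<longrightarrow> Q \<subseteq> A i p \<longrightarrow>
        emeasure (\<Pi>\<^sub>M j\<in>{1..d i}. lborel) (Q \<inter> A i (Suc p)) =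
          ennreal ((1/2) ^ (s * d i)) * emeasure (\<Pi>\<^sub>M j\<in>{1..d i}. lborel) Q)"
    by (rule bchoice[THEN exE])
  then have decr: "\<And>i p. i \<in> {1..m} \<Longrightarrow> A i (Suc p) \<subseteq> A i p"
    and meas: "\<And>i p. i \<in> {1..m} \<Longrightarrow> A i p \<in> sets (\<Pi>\<^sub>M j\<in>{1..d i}. lborel)"
    and til: "\<And>i p. i \<in> {1..m} \<Longrightarrow> tiled (d i) (D i) (\<alpha> i p) (A i p)"
    and vol: "\<And>i p. i \<in> {1..m} \<Longrightarrow> emeasure (\<Pi>\<^sub>M j\<in>{1..d i}. lborel) (A i p) =
      ennreal ((1/2) ^ (s * d i * p) * (2 powi \<alpha> i 0) ^ d i)"
    and half: "\<And>i p k Q. \<lbrakk>i \<in> {1..m}; \<alpha> i p - B i \<le> k; Q \<in> grid_level (d i) (D i) k; Q \<subseteq> A i p\<rbrakk>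
      \<Longrightarrow> emeasure (\<Pi>\<^sub>M j\<in>{1..d i}. lborel) (Q \<inter> A i (Suc p)) =
        ennreal ((1/2) ^ (s * d i)) * emeasure (\<Pi>\<^sub>M j\<in>{1..d i}. lborel) Q"
    by blast+

  \<comment> \<open>The upper bound makes the tiles fit into their generation; the lower bound keeps
    them coarse enough for the thinning proportion to hold in each.\<close>
  have scales: "\<alpha> i (l i) - B i \<le> \<kappa> l i \<and> \<kappa> l i \<le> \<alpha> i (l i)" if l: "l \<in> L" and i: "i \<in> {1..m}" for l i
  proof (cases "i = 1")
    case True
    \<comment> \<open>The block ends at \<open>M * l 1 + M - 1\<close>, which leaves one spare step
      \<open>W\<close>, and \<open>s \<le> W\<close> covers the \<open>s\<close> subtracted in
      \<open>B 1\<close>.\<close>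
    have "M * l 1 \<le> e l" "e l + 1 \<le> M * l 1 + M"
      using g_less[OF l] by (auto simp: e_def)
    then have "W * (M * l 1) \<le> W * e l" "W * (e l + 1) \<le> W * (M * l 1 + M)"
      by (simp_all only: mult_le_mono2)
    moreover have "s \<le> W"
      by (simp add: W_def)
    ultimately have "int (W * (M * l 1)) \<le> int (W * e l)"
      "int (W * e l) + int s \<le> int (W * (M * l 1)) + int (W * M)"
      unfolding of_nat_add[symmetric] of_nat_le_iff by (auto simp: algebra_simps)
    then show ?thesis
      using True m by (simp add: \<alpha>_def \<kappa>_def B_def \<alpha>\<^sub>0_def algebra_simps)
  next
    case i1: False
    show ?thesis
    proof (cases "i = 2")
      case True
      have "W * e l \<le> W * (M * N)"
        using e_less[OF l] by (intro mult_le_mono2) simp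
      then have "W * e l + S l \<le> d m * t"
        using S_le[OF l] dt_ge unfolding t_def by linarith
      then have "int (W * e l) + int (S l) \<le> int (d m * t)"
        unfolding of_nat_add[symmetric] of_nat_le_iff .
      moreover have "int (s * l m) \<le> int (s * N)"
        using sl_le[OF l, of m] m unfolding of_nat_le_iff by auto
      moreover have "\<alpha> i (l i) = int (d m * t)"
        using True L_2[OF l i] by (simp add: \<alpha>_def \<alpha>\<^sub>0_def)
      ultimately show ?thesis
        using True by (auto simp: \<kappa>_def B_def simp del: of_nat_mult of_nat_le_iff)
    next
      case False
      then show ?thesis
        using i1 by (simp add: \<alpha>_def \<kappa>_def B_def algebra_simps)
    qed
  qed

  interpret zygmund_tiling m d D \<Phi> L \<kappa> A \<epsilon>
  proof (rule zygmund_tiling.intro)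
    show "2 \<le> m"
      using m by simp
    show "dyadic_cubes (d i) (D i)" if "i \<in> {1..m}" for i
      using d[OF that] D[OF that] by unfold_locales
    show "finite L"
      by (rule finL)
    show "\<exists>i\<in>{1..m}. l i \<noteq> l' i" if "l \<in> L" "l' \<in> L" "l \<noteq> l'" for l l'
      using PiE_ext[of l "{1..m}" _ l'] that unfolding L_def by blast
    show "\<exists>i\<in>{1..m}. \<kappa> l i < \<kappa> l' i" if l: "l \<in> L" "l' \<in> L" "l \<noteq> l'" for l l'
    proof (cases "e l' < e l")
      case True
      have "W * e l' < W * e l"
        using True by (simp add: W_def)
      then have "\<kappa> l 1 < \<kappa> l' 1"
        by (simp add: \<kappa>_def flip: of_nat_mult)
      then show ?thesis
        using m by (intro bexI[of _ 1]) auto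
    next
      case False
      then have "e l + 1 \<le> e l'"
        using e_inj[OF l] by simp
      then have "W * (e l + 1) \<le> W * e l'"
        by (rule mult_le_mono2)
      \<comment> \<open>These are the lower-order terms of direction 2 that could offset one step of
        \<open>e\<close>. The summand 1 in \<open>W\<close> keeps the inequality strict even for
        \<open>s = 0\<close>.\<close>
      moreover have "S l + s * l' m < W"
      proof -
        have "W = s * (N * m) + s * N + s + 1"
          by (simp add: W_def algebra_simps)
        moreover have "s * l' m \<le> s * N"
          using m by (intro sl_le[OF l(2)]) auto
        ultimately show ?thesis
          using S_le[OF l(1)] by linarith
      qed
      ultimately have "W * e l + S l + s * l' m < W * e l' + S l' + s * l m"
        by (simp add: distrib_left)
      then have "int (W * e l) + int (S l) + int (s * l' m) < int (W * e l') + int (S l') + int (s * l m)"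
        unfolding of_nat_add[symmetric] of_nat_less_iff .
      then have "\<kappa> l 2 < \<kappa> l' 2"
        by (simp add: \<kappa>_def del: of_nat_mult)
      then show ?thesis
        using m by (intro bexI[of _ 2]) auto
    qed
    show "emeasure (\<Pi>\<^sub>M j\<in>{1..d i}. lborel) (A i p) < \<infinity>" if "i \<in> {1..m}" for i p
      by (simp add: vol[OF that])
    show "tiled (d i) (D i) (\<kappa> l i) (A i (l i))" if "l \<in> L" "i \<in> {1..m}" for l i
      using dyadic_cubes.tiled_refine[OF _ til[OF that(2)]] scales[OF that] d[OF that(2)] D[OF that(2)]
      by (simp add: dyadic_cubes_def)
    show "0 \<le> \<epsilon>" "\<epsilon> \<le> 1"
      by (auto simp: \<epsilon>_def power_le_one)
    show "emeasure (\<Pi>\<^sub>M j\<in>{1..d i}. lborel) (Q \<inter> A i (Suc (l i)))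
        \<le> ennreal \<epsilon> * emeasure (\<Pi>\<^sub>M j\<in>{1..d i}. lborel) Q"
      if "l \<in> L" "i \<in> {1..m}" "Q \<in> grid_level (d i) (D i) (\<kappa> l i)" "Q \<subseteq> A i (l i)" for l i Q
    proof -
      have "s * 1 \<le> s * d i"
        using d[OF that(2)] by (rule mult_le_mono2)
      then have "(1/2::real) ^ (s * d i) \<le> \<epsilon>"
        unfolding \<epsilon>_def by (intro power_decreasing) auto
      then show ?thesis
        using half[OF that(2) _ that(3,4)] scales[OF that(1,2)]
        by (auto intro!: mult_right_mono ennreal_leI)
    qed
    show "\<kappa> l m = \<Phi> (restrict (\<kappa> l) {1..m - 1})" if "l \<in> L" for l
    proof -
      have eq: "{1..m - 1} = insert 1 (insert 2 {3..m - 1})"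
        using m by auto
      have "\<Phi> (restrict (\<kappa> l) {1..m - 1}) = (\<Sum>i=1..m - 1. \<kappa> l i)"
        by (subst \<Phi>) auto
      also have "\<dots> = \<kappa> l 1 + \<kappa> l 2 + (\<Sum>i=3..m - 1. \<kappa> l i)"
        unfolding eq by simp
      also have "(\<Sum>i=3..m - 1. \<kappa> l i) = (\<Sum>i=3..m - 1. - int (s * l i))"
        by (intro sum.cong) (auto simp: \<kappa>_def \<alpha>\<^sub>0_def)
      also have "\<dots> = - int (S l)"
        by (simp add: S_def sum_negf)
      also have "\<kappa> l 1 + \<kappa> l 2 + - int (S l) = \<kappa> l m"
        using m by (simp add: \<kappa>_def \<alpha>\<^sub>0_def)
      finally show ?thesis ..
    qed
  qed (use decr meas in auto)

  have "(\<Prod>i\<in>{1..m}. (2 powi \<alpha> i 0 :: real) ^ d i) = (\<Prod>i\<in>{2, m}. (2 powi \<alpha> i 0) ^ d i)"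
    using m by (intro prod.mono_neutral_right) (auto simp: \<alpha>_def \<alpha>\<^sub>0_def)
  also have "\<dots> = (2 powi (int (d m * t))) ^ d 2 * (2 powi (- int (d 2 * t))) ^ d m"
    using m by (simp add: \<alpha>_def \<alpha>\<^sub>0_def)
  also have "\<dots> = 1"
    by (simp add: power_int_minus power_mult[symmetric] power_inverse ac_simps del: of_nat_mult)
  finally have prod_1: "(\<Prod>i\<in>{1..m}. (2 powi \<alpha> i 0 :: real) ^ d i) = 1" .
  have vol_prod: "emeasure (lebesgue_prod m d) (\<Pi>\<^sub>E i\<in>{1..m}. A i (q i)) =
      ennreal ((1/2) ^ (\<Sum>i=1..m. s * d i * q i))" for q
  proof -
    have "emeasure (lebesgue_prod m d) (\<Pi>\<^sub>E i\<in>{1..m}. A i (q i)) =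
        (\<Prod>i\<in>{1..m}. ennreal ((1/2) ^ (s * d i * q i) * (2 powi \<alpha> i 0) ^ d i))"
      using meas by (subst emeasure_lebesgue_prod) (auto simp: vol intro!: prod.cong)
    also have "\<dots> = ennreal (\<Prod>i\<in>{1..m}. (1/2) ^ (s * d i * q i) * (2 powi \<alpha> i 0) ^ d i)"
      by (intro prod_ennreal) auto
    also have "(\<Prod>i\<in>{1..m}. (1/2) ^ (s * d i * q i) * (2 powi \<alpha> i 0 :: real) ^ d i)
        = (1/2) ^ (\<Sum>i=1..m. s * d i * q i)"
      unfolding prod.distrib prod_1 by (simp add: power_sum)
    finally show ?thesis .
  qed

  have Union: "\<Union>family = (\<Pi>\<^sub>E i\<in>{1..m}. A i 0)"
  proof
    show "\<Union>family \<subseteq> (\<Pi>\<^sub>E i\<in>{1..m}. A i 0)"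
    proof
      fix x assume "x \<in> \<Union>family"
      then obtain l where l: "l \<in> L" "x \<in> \<Union>(tiles l)"
        by (auto simp: family_def)
      have "(\<Pi>\<^sub>E i\<in>{1..m}. A i (l i)) \<subseteq> (\<Pi>\<^sub>E i\<in>{1..m}. A i 0)"
        by (intro PiE_mono antimono_A) auto
      then show "x \<in> (\<Pi>\<^sub>E i\<in>{1..m}. A i 0)"
        using l(2) unfolding Union_tiles[OF l(1)] by (rule subsetD)
    qed
    \<comment> \<open>The zero index has the largest product set, so its tiles already fill the
      whole shadow.\<close>
    define l0 where "l0 = (\<lambda>i\<in>{1..m}. 0 :: nat)"
    have "l0 \<in> L"
      using N by (auto simp: L_def l0_def)
    have "(\<Pi>\<^sub>E i\<in>{1..m}. A i 0) = (\<Pi>\<^sub>E i\<in>{1..m}. A i (l0 i))"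
      by (intro PiE_cong) (simp add: l0_def)
    also have "\<dots> = \<Union>(tiles l0)"
      by (rule Union_tiles[OF \<open>l0 \<in> L\<close>, symmetric])
    also have "\<dots> \<subseteq> \<Union>family"
      using \<open>l0 \<in> L\<close> by (auto simp: family_def)
    finally show "(\<Pi>\<^sub>E i\<in>{1..m}. A i 0) \<subseteq> \<Union>family" .
  qed

  \<comment> \<open>\<open>q\<close> is the largest generation occurring in each direction,
    \<open>N - 1\<close> because indices are below \<open>N\<close>. Hence \<open>H\<close> lies in
    the product set of every index.\<close>
  define q where "q i = (if i = 2 then 0 else N - 1)" for i :: nat
  define H where "H = (\<Pi>\<^sub>E i\<in>{1..m}. A i (q i))"
  have "H \<in> sets (lebesgue_prod m d)"
    unfolding H_def using meas by (rule PiE_in_rectangle_space)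
  moreover have "H \<subseteq> \<Union>family"
    unfolding H_def Union by (intro PiE_mono antimono_A) auto
  moreover have "ennreal ((1/2) ^ (s * (\<Sum>i=1..m. d i) * N)) \<le> emeasure (lebesgue_prod m d) H"
  proof -
    have "(\<Sum>i=1..m. s * d i * q i) \<le> (\<Sum>i=1..m. s * d i * N)"
      by (intro sum_mono mult_le_mono2) (simp add: q_def)
    also have "\<dots> = s * (\<Sum>i=1..m. d i) * N"
      by (simp add: sum_distrib_left sum_distrib_right)
    finally show ?thesis
      unfolding H_def vol_prod by (intro ennreal_leI power_decreasing) auto
  qed
  moreover have "real (N ^ (m - 1)) \<le> counting_fun family x" if "x \<in> H" for x
    unfolding cardL[symmetric]
  proof (rule counting_fun_family_ge)
    fix l assume l: "l \<in> L"
    have "l i \<le> q i" if "i \<in> {1..m}" for i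
      using L_less[OF l that] L_2[OF l that] by (auto simp: q_def)
    then have "H \<subseteq> (\<Pi>\<^sub>E i\<in>{1..m}. A i (l i))"
      unfolding H_def by (intro PiE_mono antimono_A)
    then show "x \<in> (\<Pi>\<^sub>E i\<in>{1..m}. A i (l i))"
      using \<open>x \<in> H\<close> by (rule subsetD)
  qed
  moreover have "emeasure (lebesgue_prod m d) (\<Union>family) = 1"
    unfolding Union vol_prod[of "\<lambda>_. 0"] by simp
  ultimately show ?thesis
    using finite_family family_zygmund incomparable_family sparse_family_family
    unfolding \<epsilon>_def by blast
qed

subsection \<open>Divergence of the exponential integrals\<close>

text \<open>Supplies the thinning parameter \<open>s\<close> for the prescribed sparseness.\<close>

lemma ex_power_close_to_one:
  fixes \<eta> :: real
  assumes "\<eta> < 1"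
  shows "\<exists>s::nat. \<eta> \<le> (1 - (1/2) ^ s) ^ m"
proof -
  have "(\<lambda>s. (1 - (1/2) ^ s :: real) ^ m) \<longlonglongrightarrow> (1 - 0) ^ m"
    by (intro tendsto_intros LIMSEQ_realpow_zero) auto
  then have "eventually (\<lambda>s. \<eta> < (1 - (1/2) ^ s) ^ m) sequentially"
    using assms by (auto dest!: order_tendstoD(1)[where a=\<eta>])
  then show ?thesis
    by (metis eventually_sequentially less_imp_le order_refl)
qed

text \<open>Factoring out \<open>x\<close> leaves \<open>c * x powr (\<gamma> - 1) - K\<close>,
  whose exponent is positive; the power is written through \<open>exp\<close> and
  \<open>ln\<close>.\<close>

lemma filterlim_powr_minus_linear:
  fixes c \<gamma> K :: real
  assumes "0 < c" "1 < \<gamma>"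
  shows "filterlim (\<lambda>x. c * x powr \<gamma> - K * x) at_top at_top"
proof -
  have "filterlim (\<lambda>x. exp ((\<gamma> - 1) * ln x)) at_top at_top"
    using assms by (intro filterlim_compose[OF exp_at_top]
      filterlim_tendsto_pos_mult_at_top[OF tendsto_const] ln_at_top) auto
  then have "filterlim (\<lambda>x. c * exp ((\<gamma> - 1) * ln x)) at_top at_top"
    using assms by (intro filterlim_tendsto_pos_mult_at_top[OF tendsto_const])
  then have "filterlim (\<lambda>x. - K + c * exp ((\<gamma> - 1) * ln x)) at_top at_top"
    by (intro filterlim_tendsto_add_at_top[OF tendsto_const])
  then have "filterlim (\<lambda>x. x * (- K + c * exp ((\<gamma> - 1) * ln x))) at_top at_top"
    by (intro filterlim_at_top_mult_at_top filterlim_ident)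
  then show ?thesis
  proof (rule filterlim_mono_eventually)
    show "eventually (\<lambda>x. x * (- K + c * exp ((\<gamma> - 1) * ln x)) = c * x powr \<gamma> - K * x) at_top"
      using eventually_gt_at_top[of 0]
    proof eventually_elim
      case (elim x)
      then have "x * exp ((\<gamma> - 1) * ln x) = x powr \<gamma>"
        by (simp add: powr_def left_diff_distrib exp_diff)
      then show ?case
        by (simp add: algebra_simps)
    qed
  qed auto
qed

text \<open>Expanding the product, the subtracted term \<open>exp (- (K * real N))\<close> is at
  most 1, and the remaining exponent tends to infinity.\<close>

lemma exp_powr_dominates:
  fixes c \<gamma> K :: real
  assumes "0 < c" "1 < \<gamma>" "0 \<le> K"
  shows "filterlim (\<lambda>N. (exp (c * real N powr \<gamma>) - 1) * exp (- (K * real N))) at_top sequentially"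
proof (rule filterlim_at_top_mono)
  have "filterlim (\<lambda>N. exp (c * real N powr \<gamma> - K * real N)) at_top sequentially"
    by (intro filterlim_compose[OF exp_at_top] filterlim_real_sequentially
        filterlim_compose[OF filterlim_powr_minus_linear[OF assms(1,2)]])
  then show "filterlim (\<lambda>N. - 1 + exp (c * real N powr \<gamma> - K * real N)) at_top sequentially"
    by (intro filterlim_tendsto_add_at_top[OF tendsto_const])
  show "eventually (\<lambda>N. - 1 + exp (c * real N powr \<gamma> - K * real N)
      \<le> (exp (c * real N powr \<gamma>) - 1) * exp (- (K * real N))) sequentially"
  proof (rule always_eventually, rule allI)
    fix N :: nat
    have "exp (- (K * real N)) \<le> 1"
      using assms(3) by simp
    then show "- 1 + exp (c * real N powr \<gamma> - K * real N)
        \<le> (exp (c * real N powr \<gamma>) - 1) * exp (- (K * real N))"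
      by (simp add: left_diff_distrib exp_diff exp_minus divide_inverse)
  qed
qed

lemma sparse_family_mono:
  assumes "\<eta> \<le> \<eta>'" "sparse_family M \<eta>' G"
  shows "sparse_family M \<eta> G"
proof -
  obtain E where E: "disjoint_family_on E G"
    "\<And>I. I \<in> G \<Longrightarrow> E I \<in> sets M \<and> E I \<subseteq> I \<and> emeasure M (E I) \<ge> ennreal \<eta>' * emeasure M I"
    using assms(2) unfolding sparse_family_def by blast
  moreover have "ennreal \<eta> * emeasure M I \<le> ennreal \<eta>' * emeasure M I" for I
    using assms(1) by (intro mult_right_mono ennreal_leI) auto
  ultimately show ?thesis
    unfolding sparse_family_def by (meson order_trans)
qed

theorem theorem7p2:
  fixes m :: nat and d :: "nat \<Rightarrow> nat"
    and D :: "nat \<Rightarrow> (nat \<Rightarrow> real) set set"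
    and \<eta> :: real and \<Phi> :: "(nat \<Rightarrow> int) \<Rightarrow> int"
  assumes "m \<ge> 3"
    and "\<And>i. i \<in> {1..m} \<Longrightarrow> d i \<ge> 1"
    and "\<And>i. i \<in> {1..m} \<Longrightarrow> dyadic_grid (d i) (D i)"
    and "0 < \<eta>" and "\<eta> < 1"
    and "\<And>k. k \<in> {1..m - 1} \<rightarrow>\<^sub>E UNIV \<Longrightarrow> \<Phi> k = (\<Sum>i=1..m - 1. k i)"
  shows "\<exists>G :: nat \<Rightarrow> (nat \<Rightarrow> nat \<Rightarrow> real) set set.
    (\<forall>N\<ge>2. finite (G N) \<and> G N \<subseteq> zygmund_rectangles m d D \<Phi> \<and>
        incomparable (G N) \<and> sparse_family (lebesgue_prod m d) \<eta> (G N) \<and>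
        emeasure (lebesgue_prod m d) (\<Union>(G N)) = 1) \<and>
    (\<forall>c \<beta>. c > (0::real) \<and> \<beta> > 1 / (real m - 1) \<longrightarrow>
      (\<lambda>N. \<integral>\<^sup>+ x \<in> \<Union>(G N). ennreal (exp (c * counting_fun (G N) x powr \<beta>) - 1)
             \<partial>lebesgue_prod m d) \<longlonglongrightarrow> \<infinity>)"
proof -
  obtain s where s: "\<eta> \<le> (1 - (1/2) ^ s) ^ m"
    using ex_power_close_to_one[OF assms(5)] by blast
  define K where "K = s * (\<Sum>i=1..m. d i)"
  define P where "P N G H \<longleftrightarrow> finite G \<and> G \<subseteq> zygmund_rectangles m d D \<Phi> \<and> incomparable G \<and>
    sparse_family (lebesgue_prod m d) ((1 - (1/2) ^ s) ^ m) G \<and>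
    emeasure (lebesgue_prod m d) (\<Union>G) = 1 \<and>
    H \<in> sets (lebesgue_prod m d) \<and> H \<subseteq> \<Union>G \<and>
    ennreal ((1/2) ^ (K * N)) \<le> emeasure (lebesgue_prod m d) H \<and>
    (\<forall>x\<in>H. real (N ^ (m - 1)) \<le> counting_fun G x)" for N G H
  have "\<exists>G H. P N G H" if "2 \<le> N" for N
    unfolding P_def K_def using that by (intro zygmund_family_exists assms(1,2,3,6)) auto
  then obtain G H where GH: "\<And>N. 2 \<le> N \<Longrightarrow> P N (G N) (H N)"
    by metis
  show ?thesis
  proof (intro exI[of _ G] conjI allI impI)
    fix N :: nat assume "2 \<le> N"
    then show "finite (G N)" "G N \<subseteq> zygmund_rectangles m d D \<Phi>" "incomparable (G N)"
      "emeasure (lebesgue_prod m d) (\<Union>(G N)) = 1"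
      "sparse_family (lebesgue_prod m d) \<eta> (G N)"
      using GH[of N] sparse_family_mono[OF s] by (auto simp: P_def)
  next
    fix c \<beta> :: real assume c\<beta>: "0 < c \<and> \<beta> > 1 / (real m - 1)"
    \<comment> \<open>On \<open>H N\<close> the power \<open>h powr \<beta>\<close> is at least
      \<open>N powr \<gamma>\<close>; the assumption on \<beta> says exactly that
      \<open>\<gamma> > 1\<close>.\<close>
    define \<gamma> where "\<gamma> = real (m - 1) * \<beta>"
    have \<beta>: "0 < \<beta>" and "1 < \<gamma>"
      using c\<beta> assms(1) less_trans[of 0 "1 / (real m - 1)" \<beta>]
      by (auto simp: \<gamma>_def of_nat_diff divide_less_eq mult.commute)
    \<comment> \<open>A lower bound for the integral: the least integrand on \<open>H N\<close>
      times the bound \<open>(1/2) ^ (K * N)\<close> for its measure, written as an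
      exponential.\<close>
    define b where "b N = (exp (c * real N powr \<gamma>) - 1) * exp (- (real K * ln 2 * real N))" for N
    have "filterlim b at_top sequentially"
      unfolding b_def using c\<beta> \<open>1 < \<gamma>\<close> by (intro exp_powr_dominates) auto
    then have lim: "(\<lambda>N. ennreal (b N)) \<longlonglongrightarrow> \<infinity>"
      by (simp add: ennreal_tendsto_top_eq_at_top)
    show "(\<lambda>N. \<integral>\<^sup>+ x \<in> \<Union>(G N). ennreal (exp (c * counting_fun (G N) x powr \<beta>) - 1)
             \<partial>lebesgue_prod m d) \<longlonglongrightarrow> \<infinity>"
    \<comment> \<open>The upper bound is the constant infinity. The lower one is needed only
      eventually, as \<open>G N\<close> and \<open>H N\<close> are specified from
      \<open>N = 2\<close> on.\<close>
    proof (rule tendsto_sandwich[OF _ _ lim tendsto_const])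
      show "eventually (\<lambda>N. ennreal (b N) \<le> (\<integral>\<^sup>+ x \<in> \<Union>(G N).
          ennreal (exp (c * counting_fun (G N) x powr \<beta>) - 1) \<partial>lebesgue_prod m d)) sequentially"
        using eventually_ge_at_top[of 2]
      proof eventually_elim
        case (elim N)
        let ?w = "exp (c * real N powr \<gamma>) - 1"
        have N: "H N \<in> sets (lebesgue_prod m d)" "H N \<subseteq> \<Union>(G N)"
          "ennreal ((1/2) ^ (K * N)) \<le> emeasure (lebesgue_prod m d) (H N)"
          "\<And>x. x \<in> H N \<Longrightarrow> real (N ^ (m - 1)) \<le> counting_fun (G N) x"
          using GH[OF elim] by (auto simp: P_def)
        have "0 \<le> ?w"
          using c\<beta> by simp
        have "exp (- (real K * ln 2 * real N)) = (1/2) ^ (K * N)"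
          by (simp add: exp_minus power_one_over powr_realpow[symmetric] powr_def ac_simps inverse_eq_divide)
        then have "ennreal (b N) = ennreal ?w * ennreal ((1/2) ^ (K * N))"
          using \<open>0 \<le> ?w\<close> by (simp add: b_def ennreal_mult)
        also have "\<dots> \<le> ennreal ?w * emeasure (lebesgue_prod m d) (H N)"
          by (intro mult_left_mono N(3)) simp
        also have "\<dots> = (\<integral>\<^sup>+ x. ennreal ?w * indicator (H N) x \<partial>lebesgue_prod m d)"
          using N(1) by (simp add: nn_integral_cmult_indicator)
        also have "\<dots> \<le> (\<integral>\<^sup>+ x \<in> \<Union>(G N).
          ennreal (exp (c * counting_fun (G N) x powr \<beta>) - 1) \<partial>lebesgue_prod m d)"
        proof (rule nn_integral_mono)
          fix x
          show "ennreal ?w * indicator (H N) x \<le>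
              ennreal (exp (c * counting_fun (G N) x powr \<beta>) - 1) * indicator (\<Union>(G N)) x"
          proof (cases "x \<in> H N")
            case True
            have "real N powr \<gamma> = real (N ^ (m - 1)) powr \<beta>"
              using elim by (simp add: \<gamma>_def powr_powr[symmetric] powr_realpow)
            also have "\<dots> \<le> counting_fun (G N) x powr \<beta>"
              using N(4)[OF True] \<beta> by (intro powr_mono2) auto
            finally have "?w \<le> exp (c * counting_fun (G N) x powr \<beta>) - 1"
              using c\<beta> by simp
            then show ?thesis
              using True N(2) by (auto simp: indicator_def intro: ennreal_leI)
          qed simp
        qed
        finally show ?case .
      qed
    qed auto
  qed
qed

end
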